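(* Let $\mathfrak{g}$ be a finite-dimensional complex semisimple Lie algebra. Then any commutative post-Lie algebra structure on $\mathfrak{g}$ is trivial, i.e., $x\cdot y=0$ for all $x,y\in\mathfrak{g}$.
   Context: A commutative post-Lie algebra structure on a Lie algebra $\mathfrak{g}$ is a bilinear product $\mathfrak{g}\times\mathfrak{g}\to\mathfrak{g}$, $(x,y)\mapsto x\cdot y$, such that for all $x,y,z\in\mathfrak{g}$: $x\cdot y=y\cdot x$; $[x,y]\cdot z=x\cdot(y\cdot z)-y\cdot(x\cdot z)$; $x\cdot[y,z]=[x\cdot y,z]+[y,x\cdot z]$. *)

theory Defs
  imports Complex_Main
begin

text \<open>A Lie algebra over a field occupies a whole type; its scalar multiplication and bracket are
  parameters, so that one type may carry several such structures.\<close>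

definition bilinear_map ::
    "('k::field \<Rightarrow> 'a::ab_group_add \<Rightarrow> 'a) \<Rightarrow> ('a \<Rightarrow> 'a \<Rightarrow> 'a) \<Rightarrow> bool"
  where "bilinear_map scale f \<longleftrightarrow>
    (\<forall>x. Vector_Spaces.linear scale scale (\<lambda>y. f x y)) \<and>
    (\<forall>y. Vector_Spaces.linear scale scale (\<lambda>x. f x y))"

locale lie_algebra = vector_space scale
  for scale :: "'k::field \<Rightarrow> 'a::ab_group_add \<Rightarrow> 'a" +
  fixes bracket :: "'a \<Rightarrow> 'a \<Rightarrow> 'a"
  assumes bracket_bilinear: "bilinear_map scale bracket"
    and bracket_self: "bracket x x = 0"
    and jacobi:
      "bracket x (bracket y z) + bracket y (bracket z x) + bracket z (bracket x y) = 0"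
begin

definition lie_ideal :: "'a set \<Rightarrow> bool"
  where "lie_ideal I \<longleftrightarrow> subspace I \<and> (\<forall>x. \<forall>y\<in>I. bracket x y \<in> I)"

primrec derived_series :: "'a set \<Rightarrow> nat \<Rightarrow> 'a set"
  where
    "derived_series I 0 = I"
  | "derived_series I (Suc n) =
      span {bracket x y | x y. x \<in> derived_series I n \<and> y \<in> derived_series I n}"

definition solvable :: "'a set \<Rightarrow> bool"
  where "solvable I \<longleftrightarrow> (\<exists>n. derived_series I n = {0})"

text \<open>Semisimplicity says that the radical, i.e. the largest solvable ideal, vanishes; with this
  convention the zero Lie algebra is semisimple.\<close>

definition semisimple :: bool
  where "semisimple \<longleftrightarrow> (\<forall>I. lie_ideal I \<and> solvable I \<longrightarrow> I = {0})"

end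

locale commutative_post_lie_structure = lie_algebra scale bracket
  for scale :: "'k::field \<Rightarrow> 'a::ab_group_add \<Rightarrow> 'a"
    and bracket :: "'a \<Rightarrow> 'a \<Rightarrow> 'a" +
  fixes prod :: "'a \<Rightarrow> 'a \<Rightarrow> 'a"
  assumes prod_bilinear: "bilinear_map scale prod"
    and prod_commute: "prod x y = prod y x"
    and prod_bracket_left: "prod (bracket x y) z = prod x (prod y z) - prod y (prod x z)"
    and prod_bracket_right: "prod x (bracket y z) = bracket (prod x y) z + bracket y (prod x z)"

end

theory Submission
  imports Defs
begin

text \<open>
  The two expressions for the product of \<open>t\<close> with \<open>[a, b]\<close> give
  \<open>[a, b] t = [a, b t] - [b, a t]\<close>. Multiplying this by \<open>c\<close>, and using that the characteristic is
  not 2, yields \<open>[[a, b], c t] = [c b, a t] - [c a, b t]\<close>. It follows that every bracket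
  \<open>[(b c) a, d e]\<close> is, up to a factor of -2, a sum of values of a function of the unordered pairs
  of letters, and evaluating \<open>[[a, b], [c, d] v]\<close> in two ways shows that it vanishes. In a
  semisimple Lie algebra the centralizer of the derived algebra is a solvable ideal, hence zero;
  so \<open>[c, d] v = 0\<close>, and then each \<open>t a\<close> centralizes the derived algebra as well.
\<close>

context lie_algebra
begin

lemma bracket_hom_right: "module_hom scale scale (bracket x)"
  using bracket_bilinear by (simp add: bilinear_map_def Vector_Spaces.linear_def)

lemma bracket_hom_left: "module_hom scale scale (\<lambda>x. bracket x y)"
  using bracket_bilinear by (simp add: bilinear_map_def Vector_Spaces.linear_def)

lemmas bracket_add_right = module_hom.add[OF bracket_hom_right]
  and bracket_zero_right = module_hom.zero[OF bracket_hom_right]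
  and bracket_diff_right = module_hom.diff[OF bracket_hom_right]
  and bracket_minus_right = module_hom.neg[OF bracket_hom_right]

lemmas bracket_add_left = module_hom.add[OF bracket_hom_left]
  and bracket_scale_left = module_hom.scale[OF bracket_hom_left]
  and bracket_zero_left = module_hom.zero[OF bracket_hom_left]
  and bracket_diff_left = module_hom.diff[OF bracket_hom_left]

lemma bracket_anticommute: "bracket x y = - bracket y x"
proof -
  have "bracket (x + y) (x + y) = bracket x y + bracket y x"
    by (simp only: bracket_add_left bracket_add_right) (simp add: bracket_self)
  then show ?thesis by (simp add: bracket_self eq_neg_iff_add_eq_0)
qed

lemma bracket_derivation:
  "bracket x (bracket y z) = bracket (bracket x y) z + bracket y (bracket x z)"
  using jacobi[of x y z] bracket_anticommute[of z "bracket x y"]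
    bracket_anticommute[of z x] bracket_minus_right[of y "bracket x z"]
  by (simp add: algebra_simps)

lemma double_eq_zero:
  fixes x :: 'a
  assumes "(2::'k) \<noteq> 0" and "x + x = 0"
  shows "x = 0"
proof -
  have "scale 2 x = scale (1 + 1) x" by simp
  also have "\<dots> = 0" using assms(2) by (simp only: scale_left_distrib scale_one)
  finally show ?thesis using assms(1) by simp
qed

text \<open>Testing against brackets alone suffices, since they span the derived algebra.\<close>

definition derived_centralizer :: "'a set"
  where "derived_centralizer = {x. \<forall>y z. bracket x (bracket y z) = 0}"

lemma subspace_derived_centralizer: "subspace derived_centralizer"
  unfolding subspace_def derived_centralizer_def
  by (auto simp: bracket_zero_left bracket_add_left bracket_scale_left)

text \<open>By the derivation rule \<open>[[x, y], [a, b]]\<close> is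
  \<open>[x, [y, [a, b]]]\<close> minus \<open>[y, [x, [a, b]]]\<close>. The first vanishes by
  assumption on \<open>y\<close>, the second because \<open>[x, [a, b]]\<close> is again a bracket
  and \<open>y\<close> kills it.\<close>

lemma lie_ideal_derived_centralizer: "lie_ideal derived_centralizer"
proof -
  have "bracket x y \<in> derived_centralizer" if "y \<in> derived_centralizer" for x y
  proof -
    have "bracket (bracket x y) (bracket a b) = 0" for a b
      using bracket_derivation[of x y "bracket a b"] that
      by (simp add: derived_centralizer_def bracket_zero_right)
    then show ?thesis by (simp add: derived_centralizer_def)
  qed
  then show ?thesis by (simp add: lie_ideal_def subspace_derived_centralizer)
qed

text \<open>Elements of \<open>?C\<close> kill all brackets, hence their span \<open>?D\<close>; as
  \<open>?D\<close> lies in \<open>?C\<close>, it is abelian.\<close>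

lemma solvable_derived_centralizer: "solvable derived_centralizer"
proof -
  let ?C = derived_centralizer
  let ?D = "derived_series ?C 1"
  have "?D \<subseteq> ?C"
  proof -
    have "{bracket u v | u v. u \<in> ?C \<and> v \<in> ?C} \<subseteq> ?C"
      using lie_ideal_derived_centralizer unfolding lie_ideal_def by blast
    then show ?thesis using span_minimal[OF _ subspace_derived_centralizer] by simp
  qed
  have "bracket x y = 0" if "x \<in> ?C" "y \<in> ?D" for x y
  proof -
    have zero: "bracket x z = 0" if "z \<in> {bracket u v | u v. u \<in> ?C \<and> v \<in> ?C}" for z
      using that \<open>x \<in> ?C\<close> by (auto simp: derived_centralizer_def)
    show ?thesis
      by (rule module_hom.eq_0_on_span[OF bracket_hom_right zero]) (use \<open>y \<in> ?D\<close> in simp_all)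
  qed
  with \<open>?D \<subseteq> ?C\<close> have "{bracket x y | x y. x \<in> ?D \<and> y \<in> ?D} \<subseteq> {0}" by blast
  then have "span {bracket x y | x y. x \<in> ?D \<and> y \<in> ?D} = {0}"
    using span_minimal[OF _ subspace_single_0] span_zero by blast
  then have "derived_series ?C (Suc 1) = {0}" by (simp only: derived_series.simps)
  then show ?thesis unfolding solvable_def by blast
qed

lemma semisimple_derived_centralizer:
  assumes semisimple
    and "\<And>y z. bracket x (bracket y z) = 0"
  shows "x = 0"
proof -
  have "derived_centralizer = {0}"
    using assms(1) lie_ideal_derived_centralizer solvable_derived_centralizer
    by (simp add: semisimple_def)
  with assms(2) show ?thesis by (auto simp: derived_centralizer_def)
qed

end

context commutative_post_lie_structure
begin

notation prod (infixl "\<cdot>" 70)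
notation bracket ("\<lbrakk>_,/ _\<rbrakk>")

lemma prod_diff_right: "x \<cdot> (y - z) = x \<cdot> y - x \<cdot> z"
  using prod_bilinear by (auto simp: bilinear_map_def Vector_Spaces.linear_def dest: module_hom.diff)

lemma bracket_prod: "\<lbrakk>a, b\<rbrakk> \<cdot> t = \<lbrakk>a, b \<cdot> t\<rbrakk> - \<lbrakk>b, a \<cdot> t\<rbrakk>"
  using prod_bracket_right[of t a b] prod_commute bracket_anticommute[of "t \<cdot> a" b]
  by simp

text \<open>Multiply \<open>bracket_prod\<close> by \<open>c\<close>; expand its left side by
  \<open>prod_bracket_left\<close> and its right side by the derivation rule.\<close>

lemma bracket_prod_prod_defect:
  "\<lbrakk>c \<cdot> a, b \<cdot> t\<rbrakk> - \<lbrakk>c \<cdot> b, a \<cdot> t\<rbrakk> = \<lbrakk>\<lbrakk>b, c\<rbrakk>, a \<cdot> t\<rbrakk> + \<lbrakk>\<lbrakk>c, a\<rbrakk>, b \<cdot> t\<rbrakk>"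
proof -
  have "\<lbrakk>a, b\<rbrakk> \<cdot> (c \<cdot> t) + \<lbrakk>c, \<lbrakk>a, b\<rbrakk>\<rbrakk> \<cdot> t = c \<cdot> (\<lbrakk>a, b\<rbrakk> \<cdot> t)"
    by (simp add: prod_bracket_left[of c])
  also have "\<dots> = \<lbrakk>c \<cdot> a, b \<cdot> t\<rbrakk> + \<lbrakk>a, c \<cdot> (b \<cdot> t)\<rbrakk> - (\<lbrakk>c \<cdot> b, a \<cdot> t\<rbrakk> + \<lbrakk>b, c \<cdot> (a \<cdot> t)\<rbrakk>)"
    by (simp only: bracket_prod prod_diff_right prod_bracket_right)
  finally have "\<lbrakk>c \<cdot> a, b \<cdot> t\<rbrakk> - \<lbrakk>c \<cdot> b, a \<cdot> t\<rbrakk>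
      = \<lbrakk>a, b\<rbrakk> \<cdot> (c \<cdot> t) + \<lbrakk>c, \<lbrakk>a, b\<rbrakk>\<rbrakk> \<cdot> t - \<lbrakk>a, c \<cdot> (b \<cdot> t)\<rbrakk> + \<lbrakk>b, c \<cdot> (a \<cdot> t)\<rbrakk>"
    by (simp add: algebra_simps)
  \<comment> \<open>Nested products disappear through \<open>b (c t) - c (b t) = [b, c] t\<close>
    and its analogue for \<open>a, c\<close>.\<close>
  also have "\<dots> = \<lbrakk>a, \<lbrakk>b, c\<rbrakk> \<cdot> t\<rbrakk> - \<lbrakk>b, \<lbrakk>a, c\<rbrakk> \<cdot> t\<rbrakk> + \<lbrakk>c, \<lbrakk>a, b\<rbrakk>\<rbrakk> \<cdot> t"
    unfolding bracket_prod[of a b "c \<cdot> t"]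
    by (simp add: prod_bracket_left[of b c] prod_bracket_left[of a c] bracket_diff_right)
  also have "\<dots> = \<lbrakk>a, \<lbrakk>b, c \<cdot> t\<rbrakk>\<rbrakk> - \<lbrakk>a, \<lbrakk>c, b \<cdot> t\<rbrakk>\<rbrakk> - \<lbrakk>b, \<lbrakk>a, c \<cdot> t\<rbrakk>\<rbrakk> + \<lbrakk>b, \<lbrakk>c, a \<cdot> t\<rbrakk>\<rbrakk>
      + \<lbrakk>c, \<lbrakk>a, b \<cdot> t\<rbrakk>\<rbrakk> - \<lbrakk>c, \<lbrakk>b, a \<cdot> t\<rbrakk>\<rbrakk> - \<lbrakk>\<lbrakk>a, b\<rbrakk>, c \<cdot> t\<rbrakk>"
    by (simp add: bracket_prod bracket_diff_right)
  \<comment> \<open>Jacobi merges the two nested brackets that end in the same product; the pair for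
    \<open>c t\<close> cancels the last term.\<close>
  also have "\<dots> = \<lbrakk>\<lbrakk>b, c\<rbrakk>, a \<cdot> t\<rbrakk> + \<lbrakk>\<lbrakk>c, a\<rbrakk>, b \<cdot> t\<rbrakk>"
    by (simp add: bracket_derivation[of a b] bracket_derivation[of b c] bracket_derivation[of c a])
  finally show ?thesis .
qed

text \<open>The defect formula evaluates two of the three terms of the cyclic sum \<open>?S\<close>,
  so it remains to see that \<open>?S\<close> vanishes.\<close>

lemma bracket_bracket_prod:
  assumes "(2::'k) \<noteq> 0"
  shows "\<lbrakk>\<lbrakk>a, b\<rbrakk>, c \<cdot> t\<rbrakk> = \<lbrakk>c \<cdot> b, a \<cdot> t\<rbrakk> - \<lbrakk>c \<cdot> a, b \<cdot> t\<rbrakk>"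
proof -
  let ?S = "\<lbrakk>\<lbrakk>a, b\<rbrakk>, c \<cdot> t\<rbrakk> + \<lbrakk>\<lbrakk>b, c\<rbrakk>, a \<cdot> t\<rbrakk> + \<lbrakk>\<lbrakk>c, a\<rbrakk>, b \<cdot> t\<rbrakk>"
  \<comment> \<open>The left-hand sides of the defect formula cancel in the sum over the rotations of
    \<open>a, b, c\<close>.\<close>
  have "0 = (\<lbrakk>c \<cdot> a, b \<cdot> t\<rbrakk> - \<lbrakk>c \<cdot> b, a \<cdot> t\<rbrakk>) + (\<lbrakk>a \<cdot> b, c \<cdot> t\<rbrakk> - \<lbrakk>a \<cdot> c, b \<cdot> t\<rbrakk>)
      + (\<lbrakk>b \<cdot> c, a \<cdot> t\<rbrakk> - \<lbrakk>b \<cdot> a, c \<cdot> t\<rbrakk>)"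
    by (simp add: prod_commute[of b a] prod_commute[of c a] prod_commute[of c b])
  also have "\<dots> = ?S + ?S"
    unfolding bracket_prod_prod_defect by (simp add: algebra_simps)
  finally have "?S + ?S = 0" by (rule sym)
  then have "?S = 0" by (rule double_eq_zero[OF assms])
  then have "\<lbrakk>\<lbrakk>a, b\<rbrakk>, c \<cdot> t\<rbrakk> = - (\<lbrakk>\<lbrakk>b, c\<rbrakk>, a \<cdot> t\<rbrakk> + \<lbrakk>\<lbrakk>c, a\<rbrakk>, b \<cdot> t\<rbrakk>)"
    by (simp only: eq_neg_iff_add_eq_0 add.assoc)
  also have "\<dots> = \<lbrakk>c \<cdot> b, a \<cdot> t\<rbrakk> - \<lbrakk>c \<cdot> a, b \<cdot> t\<rbrakk>"
    by (simp only: bracket_prod_prod_defect[symmetric] minus_diff_eq)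
  finally show ?thesis .
qed

lemma bracket_bracket_prod_bracket:
  assumes two: "(2::'k) \<noteq> 0"
  shows "\<lbrakk>\<lbrakk>a, b\<rbrakk>, \<lbrakk>c, d\<rbrakk> \<cdot> v\<rbrakk> = 0"
proof -
  define T where "T a b c d e = \<lbrakk>c \<cdot> (a \<cdot> b), d \<cdot> e\<rbrakk>" for a b c d e
  \<comment> \<open>The two expansions compared in \<open>W_swap\<close> agree exactly when this
    combination is unchanged under swapping its first and third arguments.\<close>
  define W where "W a b c d e = T a b c d e - T a b d c e - T a b e c d" for a b c d e
  note H = bracket_bracket_prod[OF two]
  have T_sym: "T b a c d e = T a b c d e" "T a b c e d = T a b c d e" for a b c d e
    by (simp_all add: T_def prod_commute)
  have T_anti: "\<lbrakk>d \<cdot> e, c \<cdot> (a \<cdot> b)\<rbrakk> = - T a b c d e" for a b c d e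
    unfolding T_def by (rule bracket_anticommute)
  have T_H: "\<lbrakk>\<lbrakk>x, y\<rbrakk>, z \<cdot> (u \<cdot> w)\<rbrakk> = T u w y z x - T u w x z y" for x y z u w
    by (simp add: H T_anti)
  have W_swap: "W b c a d e = W a c b d e" for a b c d e
  proof -
    have "\<lbrakk>\<lbrakk>a, b\<rbrakk> \<cdot> c, d \<cdot> e\<rbrakk> = T b c a d e - T a c b d e"
      by (simp add: T_def prod_bracket_left bracket_diff_left)
    moreover have "\<lbrakk>\<lbrakk>a, b\<rbrakk> \<cdot> c, d \<cdot> e\<rbrakk> = \<lbrakk>\<lbrakk>a, b \<cdot> c\<rbrakk>, d \<cdot> e\<rbrakk> - \<lbrakk>\<lbrakk>b, a \<cdot> c\<rbrakk>, d \<cdot> e\<rbrakk>"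
      by (simp add: bracket_prod bracket_diff_left)
    moreover have "\<lbrakk>\<lbrakk>x, y \<cdot> z\<rbrakk>, d \<cdot> e\<rbrakk> = T y z d x e + T y z e x d" for x y z
    proof -
      have "\<lbrakk>\<lbrakk>x, y \<cdot> z\<rbrakk>, d \<cdot> e\<rbrakk> = \<lbrakk>d \<cdot> (y \<cdot> z), x \<cdot> e\<rbrakk> - \<lbrakk>x \<cdot> d, e \<cdot> (y \<cdot> z)\<rbrakk>"
        by (simp add: H prod_commute)
      also have "\<dots> = T y z d x e + T y z e x d" by (simp add: T_anti) (simp add: T_def)
      finally show ?thesis .
    qed
    ultimately show ?thesis by (simp add: W_def algebra_simps)
  qed
  have W_sym: "W b a c d e = W a b c d e" "W a b c e d = W a b c d e" for a b c d e
    by (simp_all add: W_def T_sym algebra_simps)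
  \<comment> \<open>This recovers \<open>T\<close> from \<open>W\<close>: the four other terms
    cancel by \<open>T_sym\<close>.\<close>
  have T_W: "T a b c d e + T a b c d e = - (W a b d c e + W a b e c d)" for a b c d e
    by (simp add: W_def T_sym algebra_simps)
  let ?P = "\<lbrakk>\<lbrakk>a, b\<rbrakk>, \<lbrakk>c, d\<rbrakk> \<cdot> v\<rbrakk>"
  \<comment> \<open>Here \<open>[c, d]\<close> is itself the factor moved by \<open>H\<close>; in
    \<open>P2\<close> the product \<open>[c, d] v\<close> is split first.\<close>
  have P1: "?P = T d b c a v - T c b d a v - (T d a c b v - T c a d b v)"
    unfolding H[of a b "\<lbrakk>c, d\<rbrakk>"] by (simp only: prod_bracket_left bracket_diff_left T_def)
  have P2: "?P = T d v b c a - T d v a c b - (T c v b d a - T c v a d b)"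
    by (simp only: prod_bracket_left bracket_diff_right T_H)
  have double: "(p - q - (r - s)) + (p - q - (r - s)) = p + p - (q + q) - (r + r - (s + s))"
    for p q r s :: 'a
    by (simp add: algebra_simps)
  \<comment> \<open>Rewriting to one chosen representative for each unordered pair of last arguments
    lets \<open>simp\<close> cancel.\<close>
  have W_eqs: "W d a b c v = W d b a c v" "W c a b d v = W c b a d v"
    "W d v b a c = W d b v c a" "W d v a b c = W d a v c b"
    "W c v b a d = W c b v d a" "W c v a b d = W c a v d b"
    "W d v c b a = W c v d a b" "W d v c a b = W c v d a b" "W c v d b a = W c v d a b"
    by (metis W_swap W_sym)+
  \<comment> \<open>\<open>W\<close> is symmetric in its first three and in its last two arguments, so it may be written as
    \<open>w {p, q}\<close> with \<open>p, q\<close> the last two. Then \<open>-2 ?P\<close> equals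
    \<open>w {a, c} - w {a, d} - w {b, c} + w {b, d}\<close> by \<open>P1\<close> and the negative of this by \<open>P2\<close>.\<close>
  let ?Q = "W d b v c a + W c a v d b - W c b v d a - W d a v c b"
  have "?P + ?P = - (W d b a c v + W d b v c a) - - (W c b a d v + W c b v d a)
      - (- (W d a b c v + W d a v c b) - - (W c a b d v + W c a v d b))"
    unfolding P1 double T_W ..
  also have "\<dots> = - ?Q" by (simp add: W_eqs)
  finally have "?P + ?P = - ?Q" .
  moreover have "?P + ?P = - (W d v c b a + W d v a b c) - - (W d v c a b + W d v b a c)
      - (- (W c v d b a + W c v a b d) - - (W c v d a b + W c v b a d))"
    unfolding P2 double T_W ..
  then have "?P + ?P = ?Q" by (simp add: W_eqs)
  ultimately have "(?P + ?P) + (?P + ?P) = - ?Q + ?Q" by (simp only:)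
  then have "(?P + ?P) + (?P + ?P) = 0" by (simp only: left_minus)
  then show ?thesis using double_eq_zero[OF two] by blast
qed

lemma semisimple_prod_eq_zero:
  assumes "(2::'k) \<noteq> 0" and semisimple
  shows "x \<cdot> y = 0"
proof -
  have bracket_prod_zero: "\<lbrakk>c, d\<rbrakk> \<cdot> v = 0" for c d v
  proof (rule semisimple_derived_centralizer[OF assms(2)])
    show "\<lbrakk>\<lbrakk>c, d\<rbrakk> \<cdot> v, \<lbrakk>a, b\<rbrakk>\<rbrakk> = 0" for a b
      using bracket_bracket_prod_bracket[OF assms(1)] bracket_anticommute[of _ "\<lbrakk>a, b\<rbrakk>"] by simp
  qed
  show ?thesis
  proof (rule semisimple_derived_centralizer[OF assms(2)])
    \<comment> \<open>In the derivation rule for \<open>x [y, [a, b]]\<close>, the left side and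
      \<open>[y, x [a, b]]\<close> vanish, since both contain a product with a bracket.\<close>
    show "\<lbrakk>x \<cdot> y, \<lbrakk>a, b\<rbrakk>\<rbrakk> = 0" for a b
      using prod_bracket_right[of x y "\<lbrakk>a, b\<rbrakk>"] bracket_prod_zero prod_commute[of x]
      by (simp add: bracket_zero_right)
  qed
qed

end

theorem proposition5p4:
  fixes scale :: "complex \<Rightarrow> 'a::ab_group_add \<Rightarrow> 'a"
    and bracket prod :: "'a \<Rightarrow> 'a \<Rightarrow> 'a"
  assumes "lie_algebra scale bracket"
    and "\<exists>B. finite_dimensional_vector_space scale B"
    and "lie_algebra.semisimple scale bracket"
    and "commutative_post_lie_structure scale bracket prod"
  shows "\<forall>x y. prod x y = 0"
  using commutative_post_lie_structure.semisimple_prod_eq_zero[OF assms(4) _ assms(3)] by simp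

end
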